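(* Let $\Omega\subset\mathbb{R}^n$ be open and let $u\in L^1_{loc}(\Omega)$ be real-valued. Consider the set of all points $x\in\Omega$ for which there exist real numbers $c_r$ (one for each $r>0$, possibly depending on $x$) and a non-constant function $v\in L^1(B_1)$ such that $$u^{x,r}-c_r\to v\quad\text{in }L^1(B_1)\text{ as }r\to0.$$ Then this set contains $\Sigma_u$ and can be covered by countably many $(n-1)$-dimensional Lipschitz graphs.
   Context: $B_1$ is the Euclidean unit ball of $\mathbb{R}^n$ centered at the origin. For $x\in\Omega$ and $r>0$ sufficiently small (depending on $x$), $u^{x,r}\in L^1(B_1)$ is defined by $u^{x,r}(y):=u(x+ry)$. "Non-constant" means not almost everywhere equal to a constant. The limit is the full limit as $r\to0^+$. The singular set of $u$ is $$\Sigma_u:=\{x\in\Omega:\ u^{x,r}\to v \text{ in } L^1(B_1) \text{ as } r\to 0, \text{ for some } v\in L^1(B_1) \text{ not constant}\}.$$ An $(n-1)$-dimensional Lipschitz graph in $\mathbb{R}^n$ is a set that, up to a rotation of $\mathbb{R}^n$, is the graph $\{(t,f(t)):t\in\mathbb{R}^{n-1}\}$ of a Lipschitz function $f:\mathbb{R}^{n-1}\to\mathbb{R}$. The covering is of the whole set, with no exceptional null set. *)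

theory Defs
  imports "HOL-Analysis.Analysis"
begin

definition locally_L1 :: "('a::euclidean_space \<Rightarrow> real) \<Rightarrow> 'a set \<Rightarrow> bool" where
  "locally_L1 u \<Omega> \<longleftrightarrow> (\<forall>K. compact K \<and> K \<subseteq> \<Omega> \<longrightarrow> u absolutely_integrable_on K)"

text \<open>Integrability is required explicitly, because the Bochner integral of a non-integrable
  function is 0 by convention.  The members of the family need to lie in $L^1(S)$ only eventually,
  since a blow-up is defined on the whole unit ball only for small radii.\<close>

definition L1_tendsto ::
    "'a::euclidean_space set \<Rightarrow> ('i \<Rightarrow> 'a \<Rightarrow> real) \<Rightarrow> ('a \<Rightarrow> real) \<Rightarrow> 'i filter \<Rightarrow> bool" where
  "L1_tendsto S f g F \<longleftrightarrow>
     (\<forall>\<^sub>F r in F. f r absolutely_integrable_on S) \<and>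
     g absolutely_integrable_on S \<and>
     ((\<lambda>r. LINT y:S|lebesgue. \<bar>f r y - g y\<bar>) \<longlongrightarrow> 0) F"

definition ae_constant_on :: "('a::euclidean_space \<Rightarrow> real) \<Rightarrow> 'a set \<Rightarrow> bool" where
  "ae_constant_on v S \<longleftrightarrow> (\<exists>c. AE y in lebesgue. y \<in> S \<longrightarrow> v y = c)"

definition blowup :: "('a::euclidean_space \<Rightarrow> real) \<Rightarrow> 'a \<Rightarrow> real \<Rightarrow> 'a \<Rightarrow> real" where
  "blowup u x r = (\<lambda>y. u (x + r *\<^sub>R y))"

definition singular_set :: "('a::euclidean_space \<Rightarrow> real) \<Rightarrow> 'a set \<Rightarrow> 'a set" where
  "singular_set u \<Omega> =
     {x \<in> \<Omega>. \<exists>v. v absolutely_integrable_on ball 0 1 \<and> \<not> ae_constant_on v (ball 0 1) \<and>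
        L1_tendsto (ball 0 1) (\<lambda>r. blowup u x r) v (at_right 0)}"

text \<open>The coordinate hyperplane $\{t : t_k = 0\}$, with the induced Euclidean metric, plays the
  role of $\mathbf{R}^{n-1}$ (a single point if $n = 1$), and the graph is taken over it in
  direction $e_k$.  The coordinate $k$ is arbitrary because the index type is unordered; permuting
  coordinates does not change the class of sets.\<close>

definition lipschitz_graph :: "(real ^ 'n) set \<Rightarrow> bool" where
  "lipschitz_graph G \<longleftrightarrow>
     (\<exists>(Q :: real ^ 'n ^ 'n) (k :: 'n) (f :: real ^ 'n \<Rightarrow> real) L.
        rotation_matrix Q \<and> L-lipschitz_on {t. t $ k = 0} f \<and>
        G = (\<lambda>p. Q *v p) ` {t + f t *\<^sub>R axis k 1 | t. t $ k = 0})"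

end

(* Subtract the integrals of a blow-up over two small congruent cubes: the unknown constants c_r
   cancel.  If the limit v is not constant, some such difference changes strictly when v is replaced
   by y |-> v (z + y/2), for every z in a small ball around some z0 with z0 nonzero.  A rational
   number q strictly between the two values, and rational data for the cubes, z0 and the radii,
   leave only countably many cases.  For x in one of the cases and small r, the blow-up at x of
   radius r has difference < q, while seen from z at half the scale it has difference > q.  But the
   latter is the blow-up at x + r z of radius r/2, so x + r z is not in the same case: locally each
   case has no two points whose difference lies in a cone, hence lies on a Lipschitz graph. *)

theory Submission
  imports Defs
begin

section \<open>Cube integrals and a criterion for almost everywhere constancy\<close>

text \<open>Cubes are anchored at a corner rather than at the centre, matching the form of the
  differentiation theorem \<open>integrable_ccontinuous_explicit\<close>.\<close>

definition cube_integral :: "('a::euclidean_space \<Rightarrow> real) \<Rightarrow> 'a \<Rightarrow> real \<Rightarrow> real" where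
  "cube_integral f a s = integral (cbox a (a + s *\<^sub>R One)) f"

lemma cbox_cube_subset_ball:
  fixes a :: "'a::euclidean_space"
  assumes "0 \<le> s" and "norm a + s * norm (One :: 'a) < R"
  shows "cbox a (a + s *\<^sub>R One) \<subseteq> ball 0 R"
proof
  fix x assume x: "x \<in> cbox a (a + s *\<^sub>R One)"
  have "norm (x - a) \<le> norm (s *\<^sub>R One :: 'a)"
    using x assms(1) by (intro norm_le_componentwise) (auto simp: mem_box inner_simps)
  then have "norm x \<le> norm a + s * norm (One :: 'a)"
    using norm_triangle_ineq2[of x a] assms(1) by simp
  then show "x \<in> ball 0 R"
    using assms(2) by simp
qed

text \<open>The integral over a box depends continuously on its two corners, and here both corners
  move with \<open>a\<close>. Continuity is what lets strict inequalities survive a small change of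
  the cubes.\<close>

lemma continuous_on_cube_integral:
  fixes f :: "'a::euclidean_space \<Rightarrow> real"
  assumes "\<And>a b. f integrable_on cbox a b" and "0 \<le> s"
  shows "continuous_on UNIV (\<lambda>a. cube_integral f a s)"
  unfolding continuous_on_iff
proof (intro ballI allI impI)
  fix a :: 'a and e :: real
  assume "0 < e"
  \<comment> \<open>A fixed box with margin 1 on every side: it contains both corners of each cube
    whose position is within distance 1 of \<open>a\<close>.\<close>
  let ?l = "a - One" and ?u = "a + (s + 1) *\<^sub>R One"
  have "a \<in> cbox ?l ?u" "a + s *\<^sub>R One \<in> cbox ?l ?u"
    using assms(2) by (auto simp: mem_box inner_simps)
  then obtain d where d: "0 < d"
    "\<And>c' d'. \<lbrakk>c' \<in> cbox ?l ?u; d' \<in> cbox ?l ?u; norm (c' - a) \<le> d; norm (d' - (a + s *\<^sub>R One)) \<le> d\<rbrakk>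
      \<Longrightarrow> norm (integral (cbox c' d') f - integral (cbox a (a + s *\<^sub>R One)) f) < e"
    using indefinite_integral_continuous[OF assms(1) _ _ \<open>0 < e\<close>] by metis
  have "dist (cube_integral f a' s) (cube_integral f a s) < e" if "dist a' a < min d 1" for a'
  proof -
    have "\<bar>a' \<bullet> i - a \<bullet> i\<bar> \<le> 1" if "i \<in> Basis" for i
      using Basis_le_norm[OF that, of "a' - a"] \<open>dist a' a < min d 1\<close>
      by (simp add: dist_norm inner_simps)
    then have "\<And>i. i \<in> Basis \<Longrightarrow> a' \<bullet> i - a \<bullet> i \<le> 1" "\<And>i. i \<in> Basis \<Longrightarrow> a \<bullet> i - a' \<bullet> i \<le> 1"
      by (simp_all add: abs_le_iff)
    then have "a' \<in> cbox ?l ?u" "a' + s *\<^sub>R One \<in> cbox ?l ?u"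
      using assms(2) by (fastforce simp: mem_box inner_simps)+
    then show ?thesis
      using d(2)[of a' "a' + s *\<^sub>R One"] that by (simp add: cube_integral_def dist_norm)
  qed
  then show "\<exists>d>0. \<forall>x'\<in>UNIV. dist x' a < d \<longrightarrow> dist (cube_integral f x' s) (cube_integral f a s) < e"
    using d(1) by (intro exI[of _ "min d 1"]) auto
qed

text \<open>Substitution along \<open>y\<close> to \<open>z + y/2\<close>, which carries the cube at
  \<open>a\<close> of side \<open>s\<close> onto the cube at \<open>z + a/2\<close> of side
  \<open>s/2\<close>; the power of 2 is the inverse Jacobian.\<close>

lemma cube_integral_half:
  fixes f :: "'a::euclidean_space \<Rightarrow> real"
  assumes "f integrable_on cbox (z + (1/2) *\<^sub>R a) (z + (1/2) *\<^sub>R a + (s/2) *\<^sub>R One)"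
  shows "cube_integral (\<lambda>y. f (z + (1/2) *\<^sub>R y)) a s
    = 2 ^ DIM('a) * cube_integral f (z + (1/2) *\<^sub>R a) (s/2)"
proof -
  have "((\<lambda>y. f ((1/2) *\<^sub>R y + z)) has_integral
      cube_integral f (z + (1/2) *\<^sub>R a) (s/2) /\<^sub>R (1/2) ^ DIM('a)) (cbox a (a + s *\<^sub>R One))"
    using has_integral_affinity'[OF integrable_integral[OF assms], of "1/2" z]
    by (simp add: cube_integral_def algebra_simps)
  then show ?thesis
    by (simp add: cube_integral_def integral_unique add.commute power_one_over field_simps)
qed

text \<open>Every difference of normalised averages doubles when the cubes are halved: compare
  both halves of the segment from \<open>b\<close> to \<open>a\<close> with the whole of it, translating by \<open>b/2\<close> and
  by \<open>a/2\<close>. As the averages converge almost everywhere, the limiting difference is 0.\<close>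

lemma ae_constant_on_ball_if_halving_invariant:
  fixes f :: "'a::euclidean_space \<Rightarrow> real"
  assumes int: "\<And>a b. f integrable_on cbox a b"
    and inv: "\<And>a b z j. \<lbrakk>norm a + (1/2)^j * norm (One :: 'a) < 1; norm b + (1/2)^j * norm (One :: 'a) < 1;
      norm z < 1/2\<rbrakk> \<Longrightarrow>
      2 ^ DIM('a) * (cube_integral f (z + (1/2) *\<^sub>R a) ((1/2)^j / 2) - cube_integral f (z + (1/2) *\<^sub>R b) ((1/2)^j / 2))
        = cube_integral f a ((1/2)^j) - cube_integral f b ((1/2)^j)"
  shows "ae_constant_on f (ball 0 1)"
proof -
  obtain N where N: "negligible N"
    "\<And>x e. \<lbrakk>x \<notin> N; 0 < e\<rbrakk> \<Longrightarrow> \<exists>d>0. \<forall>h. 0 < h \<and> h < d \<longrightarrow>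
        norm (integral (cbox x (x + h *\<^sub>R One)) f /\<^sub>R h ^ DIM('a) - f x) < e"
    using integrable_ccontinuous_explicit[OF int] by metis
  \<comment> \<open>The second factor is the reciprocal of the volume of a cube of side
    \<open>(1/2)^j\<close>, so \<open>G j x\<close> is an average of \<open>f\<close>.\<close>
  define G where "G j x = cube_integral f x ((1/2)^j) * (2 ^ j) ^ DIM('a)" for j x
  have half0: "(\<lambda>j. (1/2::real) ^ j) \<longlonglongrightarrow> 0"
    by (simp add: LIMSEQ_power_zero)
  have lim: "(\<lambda>j. G j x) \<longlonglongrightarrow> f x" if x: "x \<notin> N" for x
  proof (rule tendstoI)
    fix e :: real assume "0 < e"
    then obtain d where d: "0 < d" "\<forall>h. 0 < h \<and> h < d \<longrightarrow>
        norm (integral (cbox x (x + h *\<^sub>R One)) f /\<^sub>R h ^ DIM('a) - f x) < e"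
      using N(2)[OF x] by blast
    have "\<forall>\<^sub>F j in sequentially. (1/2::real) ^ j < d"
      using order_tendstoD(2)[OF half0 d(1)] .
    then show "\<forall>\<^sub>F j in sequentially. dist (G j x) (f x) < e"
    proof eventually_elim
      case (elim j)
      then show ?case
        using d(2)[rule_format, of "(1/2)^j"]
        by (simp add: G_def cube_integral_def dist_norm power_one_over divide_simps mult.commute)
    qed
  qed
  have eq: "f a = f b" if ab: "a \<in> ball 0 1 - N" "b \<in> ball 0 1 - N" for a b
  proof -
    let ?m = "(1/2) *\<^sub>R a + (1/2) *\<^sub>R b"
    have small: "\<forall>\<^sub>F j in sequentially. norm x + (1/2)^j * norm (One :: 'a) < 1" if "x \<in> ball 0 1" for x :: 'a
    proof -
      have "(\<lambda>j. norm x + (1/2)^j * norm (One :: 'a)) \<longlonglongrightarrow> norm x + 0 * norm (One :: 'a)"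
        by (intro tendsto_intros half0)
      then show ?thesis
        using that by (intro order_tendstoD(2)) auto
    qed
    have "\<forall>\<^sub>F j in sequentially. norm a + (1/2)^j * norm (One :: 'a) < 1"
      "\<forall>\<^sub>F j in sequentially. norm b + (1/2)^j * norm (One :: 'a) < 1"
      using small ab by blast+
    then have "\<forall>\<^sub>F j in sequentially. G (Suc j) a - G (Suc j) b = 2 * (G j a - G j b)"
    proof eventually_elim
      case *: (elim j)
      let ?I = "\<lambda>x. cube_integral f x ((1/2)^j / 2)"
      have "norm ((1/2) *\<^sub>R a) < 1/2" "norm ((1/2) *\<^sub>R b) < 1/2"
        using ab by auto
      from inv[OF * this(1)] inv[OF * this(2)]
      have dbl: "2 ^ DIM('a) * (?I a - ?I b) = 2 * (cube_integral f a ((1/2)^j) - cube_integral f b ((1/2)^j))"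
        by (simp add: algebra_simps flip: scaleR_add_left)
      \<comment> \<open>Passing from \<open>j\<close> to \<open>Suc j\<close> multiplies the
        normalising factor by \<open>2 ^ DIM('a)\<close>, exactly the factor in
        \<open>inv\<close>.\<close>
      have "G (Suc j) a - G (Suc j) b = (2 ^ j) ^ DIM('a) * (2 ^ DIM('a) * (?I a - ?I b))"
        by (simp add: G_def power_mult_distrib algebra_simps)
      also have "\<dots> = 2 * (G j a - G j b)"
        unfolding dbl by (simp add: G_def algebra_simps)
      finally show ?case .
    qed
    moreover have "(\<lambda>j. G (Suc j) a - G (Suc j) b) \<longlonglongrightarrow> f a - f b"
      using ab by (intro tendsto_diff LIMSEQ_Suc[of "\<lambda>j. G j a"] LIMSEQ_Suc[of "\<lambda>j. G j b"] lim) auto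
    ultimately have "(\<lambda>j. 2 * (G j a - G j b)) \<longlonglongrightarrow> f a - f b"
      by (rule Lim_transform_eventually[rotated])
    moreover have "(\<lambda>j. 2 * (G j a - G j b)) \<longlonglongrightarrow> 2 * (f a - f b)"
      using ab by (intro tendsto_intros lim) auto
    ultimately show ?thesis
      using LIMSEQ_unique by force
  qed
  have "AE y in lebesgue. y \<notin> N"
    using N(1) by (simp add: negligible_iff_null_sets AE_not_in)
  moreover obtain c where "\<And>y. y \<in> ball 0 1 - N \<Longrightarrow> f y = c"
    using eq by metis
  ultimately show ?thesis
    unfolding ae_constant_on_def by (intro exI[of _ c]) (auto elim!: eventually_mono)
qed

section \<open>Lipschitz extension and graphs from a cone condition\<close>

text \<open>McShane extension: take the infimum of the functions \<open>g p + L * dist x p\<close>,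
  each of which is L-Lipschitz in \<open>x\<close>. The empty domain is separate, since the infimum
  needs a nonempty family.\<close>

lemma lipschitz_on_extension_real:
  fixes g :: "'a::metric_space \<Rightarrow> real"
  assumes g: "L-lipschitz_on A g"
  obtains f where "L-lipschitz_on UNIV f" "\<And>x. x \<in> A \<Longrightarrow> f x = g x"
proof (cases "A = {}")
  case True
  show ?thesis
    using lipschitz_on_nonneg[OF g] True by (intro that[of "\<lambda>_. 0"]) (auto intro: lipschitz_onI)
next
  case False
  have L: "0 \<le> L"
    using lipschitz_on_nonneg[OF g] .
  \<comment> \<open>This inequality serves twice: it bounds the infimum from below, and at
    \<open>x = p\<close> it shows that the extension is at least \<open>g\<close> on
    \<open>A\<close>.\<close>
  have g_le: "g p - L * dist x p \<le> g q + L * dist x q" if "p \<in> A" "q \<in> A" for p q x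
  proof -
    have "g p - g q \<le> L * dist p q"
      using lipschitz_onD[OF g that] by (simp add: dist_real_def)
    also have "\<dots> \<le> L * (dist x p + dist x q)"
      using L dist_triangle3[of p q x] by (intro mult_left_mono) auto
    finally show ?thesis
      by (simp add: algebra_simps)
  qed
  define f where "f x = (INF p\<in>A. g p + L * dist x p)" for x
  have bdd: "bdd_below ((\<lambda>p. g p + L * dist x p) ` A)" for x
    using False g_le by (meson bdd_below.I2 ex_in_conv)
  have le: "f x \<le> f y + L * dist x y" for x y
  proof -
    have "f x - L * dist x y \<le> f y"
      unfolding f_def[of y]
    proof (rule cINF_greatest[OF False])
      fix p assume p: "p \<in> A"
      have "f x \<le> g p + L * dist x p"
        unfolding f_def by (rule cINF_lower[OF bdd p])
      also have "\<dots> \<le> g p + L * (dist x y + dist y p)"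
        using L dist_triangle by (intro add_left_mono mult_left_mono) auto
      finally show "f x - L * dist x y \<le> g p + L * dist y p"
        by (simp add: algebra_simps)
    qed
    then show ?thesis
      by simp
  qed
  have "L-lipschitz_on UNIV f"
  proof (rule lipschitz_onI[OF _ L])
    fix x y
    show "dist (f x) (f y) \<le> L * dist x y"
      using le[of x y] le[of y x] by (simp add: dist_real_def dist_commute abs_le_iff)
  qed
  moreover have "f x = g x" if "x \<in> A" for x
  proof (rule antisym)
    show "f x \<le> g x"
      using cINF_lower[OF bdd that, of x] by (simp add: f_def)
    show "g x \<le> f x"
      unfolding f_def using g_le[OF that, of _ x] by (intro cINF_greatest[OF False]) auto
  qed
  ultimately show ?thesis
    using that by blast
qed

text \<open>A difference of two points of \<open>B\<close> avoids the open cone around the axis, so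
  its height is at most \<open>c / d\<close> times the length of its horizontal part. Hence the
  projection is injective on \<open>B\<close>, and height is a Lipschitz function of the projection,
  which extends to the whole hyperplane.\<close>

lemma cone_condition_imp_graph_over_hyperplane:
  fixes B :: "(real ^ 'n) set"
  assumes "0 < c" "0 < d"
    and cone: "\<And>x t y. \<lbrakk>x \<in> B; 0 < t; y \<in> ball (c *\<^sub>R axis k 1) d\<rbrakk> \<Longrightarrow> x + t *\<^sub>R y \<notin> B"
  obtains f L where "L-lipschitz_on {t. t $ k = 0} f"
    "B \<subseteq> {t + f t *\<^sub>R axis k 1 | t. t $ k = 0}"
proof -
  let ?e = "axis k 1 :: real ^ 'n"
  define \<pi> where "\<pi> p = p - (p $ k) *\<^sub>R ?e" for p :: "real ^ 'n"
  have less: "p $ k - q $ k \<le> c / d * norm (\<pi> p - \<pi> q)" if "p \<in> B" "q \<in> B" for p q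
  proof (rule ccontr)
    assume *: "\<not> ?thesis"
    define h where "h = p $ k - q $ k"
    have h: "c / d * norm (\<pi> p - \<pi> q) < h"
      using * by (simp add: h_def)
    then have "0 < h"
      using assms(1,2) by (smt (verit) divide_nonneg_pos mult_nonneg_nonneg norm_ge_zero)
    \<comment> \<open>Rescaling \<open>p - q\<close> to height \<open>c\<close> makes it comparable
      with the centre of the ball that spans the cone.\<close>
    define y where "y = (c / h) *\<^sub>R (p - q)"
    have "y - c *\<^sub>R ?e = (c / h) *\<^sub>R (p - q - h *\<^sub>R ?e)"
      using \<open>0 < h\<close> by (simp add: y_def scaleR_diff_right)
    also have "p - q - h *\<^sub>R ?e = \<pi> p - \<pi> q"
      by (simp add: \<pi>_def h_def scaleR_diff_left)
    finally have "norm (y - c *\<^sub>R ?e) = c / h * norm (\<pi> p - \<pi> q)"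
      using \<open>0 < c\<close> \<open>0 < h\<close> by simp
    also have "\<dots> < d"
      using h \<open>0 < h\<close> assms(1,2) by (simp add: field_simps)
    finally have "y \<in> ball (c *\<^sub>R ?e) d"
      by (simp add: dist_norm norm_minus_commute)
    moreover have "q + (h / c) *\<^sub>R y = p"
      using \<open>0 < h\<close> \<open>0 < c\<close> by (simp add: y_def)
    ultimately show False
      using cone[of q "h / c" y] that \<open>0 < h\<close> \<open>0 < c\<close> by simp
  qed
  then have lip: "\<bar>p $ k - q $ k\<bar> \<le> c / d * dist (\<pi> p) (\<pi> q)" if "p \<in> B" "q \<in> B" for p q
    using less[OF that] less[OF that(2,1)] by (simp add: dist_norm norm_minus_commute abs_le_iff)
  have inj: "inj_on \<pi> B"
  proof (rule inj_onI)
    fix p q assume pq: "p \<in> B" "q \<in> B" "\<pi> p = \<pi> q"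
    then have "p $ k = q $ k"
      using lip[OF pq(1,2)] by simp
    then show "p = q"
      using pq(3) by (simp add: \<pi>_def)
  qed
  have "(c / d)-lipschitz_on (\<pi> ` B) (\<lambda>t. inv_into B \<pi> t $ k)"
    using lip assms(1,2) inj by (intro lipschitz_onI) (auto simp: dist_real_def)
  then obtain f where f: "(c / d)-lipschitz_on UNIV f" "\<And>t. t \<in> \<pi> ` B \<Longrightarrow> f t = inv_into B \<pi> t $ k"
    using lipschitz_on_extension_real by blast
  show ?thesis
  proof (rule that)
    show "(c / d)-lipschitz_on {t. t $ k = 0} f"
      using f(1) lipschitz_on_subset by blast
    show "B \<subseteq> {t + f t *\<^sub>R ?e | t. t $ k = 0}"
    proof
      fix p assume "p \<in> B"
      then have "f (\<pi> p) = p $ k"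
        using f(2) inj by simp
      then have "p = \<pi> p + f (\<pi> p) *\<^sub>R ?e" "\<pi> p $ k = 0"
        by (auto simp: \<pi>_def)
      then show "p \<in> {t + f t *\<^sub>R ?e | t. t $ k = 0}"
        by blast
    qed
  qed
qed

text \<open>The sign is needed in dimension 1, where the only rotation is the identity.\<close>

lemma rotation_matrix_axis_to_line:
  fixes z :: "real ^ 'n"
  obtains Q :: "real ^ 'n ^ 'n" and \<sigma> :: real
  where "rotation_matrix Q" "\<bar>\<sigma>\<bar> = 1" "Q *v (norm z *\<^sub>R axis k 1) = \<sigma> *\<^sub>R z"
proof (cases "z = 0")
  case True
  then show ?thesis
    by (intro that[of "mat 1" 1]) (auto simp: rotation_matrix_def orthogonal_matrix_id)
next
  case False
  show ?thesis
  proof (cases "2 \<le> CARD('n)")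
    case True
    have "norm (z /\<^sub>R norm z) = 1"
      using False by simp
    then obtain Q :: "real ^ 'n ^ 'n" where "rotation_matrix Q" "Q *v axis k 1 = z /\<^sub>R norm z"
      using rotation_matrix_exists_basis[OF True] by blast
    then show ?thesis
      using False by (intro that[of Q 1]) (simp_all add: matrix_vector_mult_scaleR)
  next
    case False
    then have one: "CARD('n) = 1"
      using zero_less_card_finite[where 'a='n] by linarith
    then have eqI: "v = w" if "v $ k = w $ k" for v w :: "real ^ 'n"
      using that by (metis card_1_singletonE UNIV_I singletonD vec_eq_iff)
    have z: "z = (z $ k) *\<^sub>R axis k 1"
      by (rule eqI) simp
    then have "norm z = \<bar>z $ k\<bar>"
      by (metis norm_axis_1 norm_scaleR mult.right_neutral)
    then have "norm z *\<^sub>R axis k 1 = (if 0 \<le> z $ k then 1 else - 1) *\<^sub>R z"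
      by (intro eqI) simp
    then show ?thesis
      by (intro that[of "mat 1" "if 0 \<le> z $ k then 1 else - 1"])
        (auto simp: rotation_matrix_def orthogonal_matrix_id)
  qed
qed

text \<open>A rotation takes a coordinate axis to the line through \<open>z0\<close>, which reduces
  the claim to a cone around the axis. A reversed direction is harmless, because exchanging the two
  points negates their difference.\<close>

lemma cone_condition_imp_subset_lipschitz_graph:
  fixes A :: "(real ^ 'n) set"
  assumes "z0 \<noteq> 0" "0 < d"
    and cone: "\<And>x t y. \<lbrakk>x \<in> A; 0 < t; y \<in> ball z0 d\<rbrakk> \<Longrightarrow> x + t *\<^sub>R y \<notin> A"
  obtains G where "lipschitz_graph G" "A \<subseteq> G"
proof -
  fix k :: 'n
  obtain Q :: "real ^ 'n ^ 'n" and \<sigma> where Q: "rotation_matrix Q" and \<sigma>: "\<bar>\<sigma>\<bar> = 1"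
    and Qk: "Q *v (norm z0 *\<^sub>R axis k 1) = \<sigma> *\<^sub>R z0"
    using rotation_matrix_axis_to_line by blast
  have orth: "orthogonal_matrix Q"
    using Q by (simp add: rotation_matrix_def)
  then have iso: "norm (Q *v x) = norm x" for x
    using orthogonal_transformation_norm[of "(*v) Q"]
    by (simp add: orthogonal_transformation_matrix matrix_of_matrix_vector_mul)
  define B where "B = {x. Q *v x \<in> A}"
  have B: "x + t *\<^sub>R y \<notin> B" if "x \<in> B" "0 < t" "y \<in> ball (norm z0 *\<^sub>R axis k 1) d" for x t y
  proof
    assume *: "x + t *\<^sub>R y \<in> B"
    have "norm (\<sigma> *\<^sub>R z0 - Q *v y) < d"
      using that(3) iso[of "norm z0 *\<^sub>R axis k 1 - y"]
      by (simp add: dist_norm Qk matrix_vector_mult_diff_distrib)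
    then have "norm (\<sigma> *\<^sub>R (\<sigma> *\<^sub>R z0 - Q *v y)) < d"
      using \<sigma> by simp
    moreover have ss: "\<sigma> * \<sigma> = 1"
      using \<sigma> by (metis abs_mult_self_eq mult_1)
    ultimately have y: "\<sigma> *\<^sub>R (Q *v y) \<in> ball z0 d"
      by (simp add: dist_norm scaleR_diff_right)
    have A: "Q *v x \<in> A" "Q *v x + t *\<^sub>R (Q *v y) \<in> A"
      using * \<open>x \<in> B\<close> by (simp_all add: B_def matrix_vector_right_distrib matrix_vector_mult_scaleR)
    from \<sigma> consider "\<sigma> = 1" | "\<sigma> = - 1"
      by linarith
    then show False
    proof cases
      case 1
      then show False
        using cone[OF A(1) \<open>0 < t\<close> y] A(2) by simp
    next
      \<comment> \<open>The rotated direction points along \<open>- z0\<close>, so the cone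
        condition is applied at the other endpoint and leads back to the first one.\<close>
      case 2
      then show False
        using cone[OF A(2) \<open>0 < t\<close> y] A(1) by simp
    qed
  qed
  have "0 < norm z0"
    using assms(1) by simp
  then obtain f L where f: "L-lipschitz_on {t. t $ k = 0} f"
    "B \<subseteq> {t + f t *\<^sub>R axis k 1 | t. t $ k = 0}"
    by (rule cone_condition_imp_graph_over_hyperplane[OF _ assms(2) B]) blast+
  have "x \<in> (*v) Q ` B" if "x \<in> A" for x
  proof
    show "x = Q *v (transpose Q *v x)"
      using orth by (simp add: orthogonal_matrix_def matrix_vector_mul_assoc del: transpose_matrix_vector)
    then show "transpose Q *v x \<in> B"
      using that by (simp add: B_def)
  qed
  then have "A \<subseteq> (*v) Q ` {t + f t *\<^sub>R axis k 1 | t. t $ k = 0}"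
    using f(2) by blast
  then show ?thesis
    using Q f(1) by (intro that) (auto simp: lipschitz_graph_def)
qed

section \<open>Differences over two cubes and the halving test\<close>

definition cube_difference :: "('a::euclidean_space \<Rightarrow> real) \<Rightarrow> 'a \<Rightarrow> 'a \<Rightarrow> real \<Rightarrow> real" where
  "cube_difference f a b s = cube_integral f a s - cube_integral f b s"

text \<open>The norm bounds keep both halved cubes inside the unit ball, where \<open>f\<close> is
  integrable: \<open>z\<close> contributes less than 1/2, and so does half of a cube bounded by
  1.\<close>

lemma cube_difference_half:
  fixes f :: "'a::euclidean_space \<Rightarrow> real"
  assumes "f absolutely_integrable_on ball 0 1" "0 \<le> s" "norm z < 1/2"
    "norm a + s * norm (One :: 'a) < 1" "norm b + s * norm (One :: 'a) < 1"
  shows "cube_difference (\<lambda>y. f (z + (1/2) *\<^sub>R y)) a b s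
    = 2 ^ DIM('a) * cube_difference f (z + (1/2) *\<^sub>R a) (z + (1/2) *\<^sub>R b) (s/2)"
proof -
  have "f integrable_on cbox (z + (1/2) *\<^sub>R x) (z + (1/2) *\<^sub>R x + (s/2) *\<^sub>R One)"
    if "norm x + s * norm (One :: 'a) < 1" for x
  proof -
    have "cbox (z + (1/2) *\<^sub>R x) (z + (1/2) *\<^sub>R x + (s/2) *\<^sub>R One) \<subseteq> ball 0 1"
      using assms(2,3) that norm_triangle_ineq[of z "(1/2) *\<^sub>R x"]
      by (intro cbox_cube_subset_ball) (auto simp: field_simps)
    then show ?thesis
      using absolutely_integrable_on_subcbox[OF assms(1)] set_lebesgue_integral_eq_integral(1) by blast
  qed
  then show ?thesis
    using assms(4,5) by (simp add: cube_difference_def cube_integral_half right_diff_distrib)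
qed

text \<open>Subtracting a constant does not change the difference, so the constants \<open>c\<close> that
  normalise the blow-ups disappear here.\<close>

lemma cube_difference_L1_estimate:
  fixes f g :: "'a::euclidean_space \<Rightarrow> real"
  assumes f: "f absolutely_integrable_on ball 0 1"
    and g: "(\<lambda>y. g y - c) absolutely_integrable_on ball 0 1"
    and "0 \<le> s" "norm a + s * norm (One :: 'a) < 1" "norm b + s * norm (One :: 'a) < 1"
  shows "\<bar>cube_difference g a b s - cube_difference f a b s\<bar>
    \<le> 2 * (LINT y:ball 0 1|lebesgue. \<bar>g y - c - f y\<bar>)"
proof -
  let ?D = "\<lambda>y. g y - c - f y"
  have D: "?D absolutely_integrable_on ball 0 1"
    using g f by (rule set_integral_diff)
  then have aD: "(\<lambda>y. \<bar>?D y\<bar>) absolutely_integrable_on ball 0 1"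
    by (rule set_integrable_abs)
  have *: "\<bar>cube_integral ?D x s\<bar> \<le> (LINT y:ball 0 1|lebesgue. \<bar>?D y\<bar>) \<and>
    cube_integral ?D x s = cube_integral g x s - c * s ^ DIM('a) - cube_integral f x s"
    if "norm x + s * norm (One :: 'a) < 1" for x
  proof -
    let ?K = "cbox x (x + s *\<^sub>R One)"
    have K: "?K \<subseteq> ball 0 1"
      using that assms(3) by (rule cbox_cube_subset_ball[rotated])
    have int: "h integrable_on ?K" if "h absolutely_integrable_on ball 0 1" for h :: "'a \<Rightarrow> real"
      using absolutely_integrable_on_subcbox[OF that K] set_lebesgue_integral_eq_integral(1) by blast
    have "\<bar>cube_integral ?D x s\<bar> \<le> integral ?K (\<lambda>y. \<bar>?D y\<bar>)"
      unfolding cube_integral_def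
      using integral_norm_bound_integral[OF int[OF D] int[OF aD]] by simp
    also have "\<dots> \<le> integral (ball 0 1) (\<lambda>y. \<bar>?D y\<bar>)"
      using K int[OF aD] set_lebesgue_integral_eq_integral(1)[OF aD]
      by (intro integral_subset_le) auto
    also have "\<dots> = (LINT y:ball 0 1|lebesgue. \<bar>?D y\<bar>)"
      using set_lebesgue_integral_eq_integral(2)[OF aD] by simp
    finally have 1: "\<bar>cube_integral ?D x s\<bar> \<le> (LINT y:ball 0 1|lebesgue. \<bar>?D y\<bar>)" .
    have gc: "(\<lambda>y. g y - c) integrable_on ?K" and fK: "f integrable_on ?K"
      by (fact int[OF g] int[OF f])+
    have gK: "g integrable_on ?K"
      using integrable_add[OF gc integrable_const[of c]] by simp
    have cont: "measure lborel ?K = s ^ DIM('a)"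
      using assms(3) by (simp add: content_cbox_plus)
    have "integral ?K ?D = integral ?K g - c * s ^ DIM('a) - integral ?K f"
      using integral_diff[OF gc fK] integral_diff[OF gK integrable_const[of c]] cont
      by (simp add: mult.commute)
    with 1 show ?thesis
      by (simp add: cube_integral_def)
  qed
  \<comment> \<open>The two cubes have equal volume, so the terms \<open>c * s ^ DIM('a)\<close>
    cancel; each cube contributes one L1 norm to the bound.\<close>
  show ?thesis
    using *[OF assms(4)] *[OF assms(5)] unfolding cube_difference_def by linarith
qed

lemma cube_difference_commute: "cube_difference f b a s = - cube_difference f a b s"
  by (simp add: cube_difference_def)

text \<open>The constancy criterion must fail for some cubes and some \<open>z\<close>. The
  resulting strict inequality is an open condition on the triple \<open>(a, b, z)\<close>, so the
  triple can be moved into the dense set \<open>D\<close>, while \<open>j\<close> stays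
  fixed.\<close>

lemma nonconstant_imp_halving_test:
  fixes f :: "'a::euclidean_space \<Rightarrow> real"
  assumes int: "\<And>a b. f integrable_on cbox a b"
    and nc: "\<not> ae_constant_on f (ball 0 1)"
    and dense: "\<And>X. open X \<Longrightarrow> X \<noteq> {} \<Longrightarrow> \<exists>d\<in>D. d \<in> X"
  obtains a b z j where "(a, b, z) \<in> D" "z \<noteq> 0" "norm z < 1/2"
    "norm a + (1/2)^j * norm (One :: 'a) < 1" "norm b + (1/2)^j * norm (One :: 'a) < 1"
    "cube_difference f a b ((1/2)^j)
      < 2 ^ DIM('a) * cube_difference f (z + (1/2) *\<^sub>R a) (z + (1/2) *\<^sub>R b) ((1/2)^j / 2)"
proof -
  define S where "S j = (1/2::real)^j" for j :: nat
  have S: "0 \<le> S j" for j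
    by (simp add: S_def)
  define good where "good j = (\<lambda>(a :: 'a, b, z). norm z < 1/2 \<and>
    norm a + S j * norm (One :: 'a) < 1 \<and> norm b + S j * norm (One :: 'a) < 1 \<and>
    cube_difference f a b (S j) < 2 ^ DIM('a) * cube_difference f (z + (1/2) *\<^sub>R a) (z + (1/2) *\<^sub>R b) (S j / 2))" for j
  obtain j a b z where abz: "good j (a, b, z)"
  proof -
    obtain a b z j where *: "norm z < 1/2"
      "norm a + S j * norm (One :: 'a) < 1" "norm b + S j * norm (One :: 'a) < 1"
      "2 ^ DIM('a) * cube_difference f (z + (1/2) *\<^sub>R a) (z + (1/2) *\<^sub>R b) (S j / 2)
        \<noteq> cube_difference f a b (S j)"
      using ae_constant_on_ball_if_halving_invariant[OF int] nc
      unfolding cube_difference_def S_def by blast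
    \<comment> \<open>Exchanging the cubes negates both sides, which turns the inequality into the
      required direction.\<close>
    then have "good j (a, b, z) \<or> good j (b, a, z)"
      unfolding good_def
      by (auto simp: neq_iff cube_difference_commute[of f b a] cube_difference_commute[of f "z + (1/2) *\<^sub>R b"])
    then show ?thesis
      using that by blast
  qed
  define U where "U = {p. good j p}"
  have cont: "continuous_on UNIV (\<lambda>p. cube_integral f (h p) s)"
    if "continuous_on UNIV h" "0 \<le> s" for h :: "'a \<times> 'a \<times> 'a \<Rightarrow> 'a" and s
    using continuous_on_compose2[OF continuous_on_cube_integral[OF int that(2)] that(1)] by simp
  have "open U"
    unfolding U_def good_def cube_difference_def case_prod_beta
    by (intro open_Collect_conj open_Collect_less continuous_intros cont) (auto simp: S)
  \<comment> \<open>The admissible \<open>z\<close> form a nonempty open set, which cannot be the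
    single point 0; a nonzero \<open>z\<close> is what gives the later cone a direction.\<close>
  define V where "V = {z'. (a, b, z') \<in> U}"
  have "open V"
    using open_vimage[OF \<open>open U\<close>, of "\<lambda>z'. (a, b, z')"]
    by (simp add: V_def vimage_def continuous_intros)
  moreover have "z \<in> V"
    using abz by (simp add: V_def U_def)
  ultimately obtain z' where "z' \<in> V" "z' \<noteq> 0"
    by (metis not_open_singleton is_singletonI' empty_iff is_singleton_the_elem singletonI)
  then have "(a, b, z') \<in> U \<inter> {p. snd (snd p) \<noteq> 0}"
    by (simp add: V_def)
  moreover have "open (U \<inter> {p. snd (snd p) \<noteq> 0})"
    by (intro open_Int \<open>open U\<close> open_Collect_neq continuous_intros)
  ultimately obtain p where "p \<in> D" "p \<in> U" "snd (snd p) \<noteq> 0"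
    using dense by blast
  then show ?thesis
    using that[of "fst p" "fst (snd p)" "snd (snd p)" j]
    by (auto simp: U_def good_def S_def case_prod_beta)
qed

section \<open>Points passing a test and their local cone condition\<close>

text \<open>One case of the decomposition: \<open>q\<close> separates the two values uniformly over
  all radii below \<open>\<rho>\<close> and all \<open>z\<close> near \<open>z0\<close>. The set
  grows as \<open>d\<close> and \<open>\<rho>\<close> shrink, so both may be rounded down to a
  countable range.\<close>

definition separated_points ::
    "('a::euclidean_space \<Rightarrow> real) \<Rightarrow> 'a \<Rightarrow> 'a \<Rightarrow> 'a \<Rightarrow> real \<Rightarrow> real \<Rightarrow> real \<Rightarrow> real \<Rightarrow> 'a set" where
  "separated_points u a b z0 s q d \<rho> = {x. \<forall>r z. 0 < r \<and> r < \<rho> \<and> z \<in> ball z0 d \<longrightarrow>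
     cube_difference (blowup u x r) a b s < q \<and>
     q < cube_difference (\<lambda>y. blowup u x r (z + (1/2) *\<^sub>R y)) a b s}"

text \<open>The blow-up of \<open>u\<close> at \<open>x\<close> of radius \<open>r\<close>, seen from \<open>z\<close> at half the scale, is the
  blow-up at \<open>x + r z\<close> of radius \<open>r/2\<close>.\<close>

lemma separated_points_cone_condition:
  assumes "x \<in> separated_points u a b z0 s q d \<rho>" "0 < r" "r < \<rho>" "z \<in> ball z0 d"
  shows "x + r *\<^sub>R z \<notin> separated_points u a b z0 s q d \<rho>"
proof
  assume "x + r *\<^sub>R z \<in> separated_points u a b z0 s q d \<rho>"
  then have "cube_difference (blowup u (x + r *\<^sub>R z) (r/2)) a b s < q"
    using assms(2-4) by (auto simp: separated_points_def)
  moreover have "blowup u (x + r *\<^sub>R z) (r/2) = (\<lambda>y. blowup u x r (z + (1/2) *\<^sub>R y))"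
    by (simp add: blowup_def fun_eq_iff algebra_simps)
  ultimately show False
    using assms by (fastforce simp: separated_points_def)
qed

text \<open>Separation excludes only displacements \<open>t * y\<close> with
  \<open>t < \<rho>\<close>. Inside a ball of diameter \<open>\<rho> * norm z0 / 2\<close> no larger
  \<open>t\<close> can occur, so the full cone condition holds there.\<close>

lemma separated_points_localized_subset_lipschitz_graph:
  fixes u :: "real ^ 'n \<Rightarrow> real"
  assumes "z0 \<noteq> 0" "0 < d"
  obtains G where "lipschitz_graph G"
    "separated_points u a b z0 s q d \<rho> \<inter> ball p (\<rho> * norm z0 / 4) \<subseteq> G"
proof -
  let ?A = "separated_points u a b z0 s q d \<rho> \<inter> ball p (\<rho> * norm z0 / 4)"
  \<comment> \<open>The bound \<open>norm z0 / 2\<close> on the radius keeps \<open>norm y\<close>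
    above \<open>norm z0 / 2\<close>, so that the distance of the two points controls
    \<open>t\<close>.\<close>
  have "x + t *\<^sub>R y \<notin> ?A" if x: "x \<in> ?A" and t: "0 < t" and y: "y \<in> ball z0 (min d (norm z0 / 2))" for x t y
  proof
    assume xt: "x + t *\<^sub>R y \<in> ?A"
    have "norm z0 / 2 < norm y"
      using y norm_triangle_ineq2[of z0 y] by (simp add: dist_norm)
    then have "t * (norm z0 / 2) < t * norm y"
      using t by simp
    also have "\<dots> = dist x (x + t *\<^sub>R y)"
      using t by (simp add: dist_norm)
    also have "\<dots> < \<rho> * norm z0 / 4 + \<rho> * norm z0 / 4"
      using x xt dist_triangle3[of x "x + t *\<^sub>R y" p] by auto
    finally have "t < \<rho>"
      using assms(1) by simp
    then show False
      using separated_points_cone_condition[of x u a b z0 s q d \<rho> t y] x xt t y by auto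
  qed
  then show ?thesis
    using cone_condition_imp_subset_lipschitz_graph[of z0 "min d (norm z0 / 2)" ?A] assms that
    by (metis min_less_iff_conj half_gt_zero zero_less_norm_iff)
qed

text \<open>Both strict inequalities hold for the limit \<open>f\<close> and pass to the blow-ups of
  small radius. The L1 error does not depend on \<open>z\<close>, so continuity of the limiting
  value in \<open>z\<close> makes the second one uniform near \<open>z0\<close>.\<close>

lemma L1_tendsto_imp_separated_point:
  fixes f u :: "'a::euclidean_space \<Rightarrow> real"
  assumes int: "\<And>a b. f integrable_on cbox a b"
    and L1: "L1_tendsto (ball 0 1) (\<lambda>r y. blowup u x r y - c r) f (at_right 0)"
    and z0: "norm z0 < 1/2"
    and a: "norm a + s * norm (One :: 'a) < 1" and b: "norm b + s * norm (One :: 'a) < 1" and s: "0 \<le> s"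
    and q1: "cube_difference f a b s < q"
    and q2: "q < 2 ^ DIM('a) * cube_difference f (z0 + (1/2) *\<^sub>R a) (z0 + (1/2) *\<^sub>R b) (s/2)"
  obtains d \<rho> where "0 < d" "0 < \<rho>"
    "\<And>d' \<rho>'. \<lbrakk>d' \<le> d; \<rho>' \<le> \<rho>\<rbrakk> \<Longrightarrow> x \<in> separated_points u a b z0 s q d' \<rho>'"
proof -
  let ?N = "2 ^ DIM('a) :: real"
  define F where "F z = ?N * cube_difference f (z + (1/2) *\<^sub>R a) (z + (1/2) *\<^sub>R b) (s/2)" for z
  define e where "e r = (LINT y:ball 0 1|lebesgue. \<bar>blowup u x r y - c r - f y\<bar>)" for r
  \<comment> \<open>Half of the gap at \<open>z0\<close>: one half is spent on moving
    \<open>z\<close>, the other is left for the L1 error.\<close>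
  define \<eta> where "\<eta> = (F z0 - q) / 2"
  have \<eta>: "0 < \<eta>" and F_z0: "q + \<eta> < F z0"
    using q2 by (simp_all add: \<eta>_def F_def field_simps)
  have "continuous_on UNIV (\<lambda>z. cube_integral f (z + (1/2) *\<^sub>R p) (s/2))" for p
    using s by (intro continuous_on_compose2[OF continuous_on_cube_integral[OF int]] continuous_intros) auto
  then have "continuous_on UNIV F"
    unfolding F_def cube_difference_def by (intro continuous_intros)
  then have "open ({z. q + \<eta> < F z} \<inter> ball 0 (1/2))"
    by (intro open_Int open_Collect_less continuous_intros) auto
  moreover have "z0 \<in> {z. q + \<eta> < F z} \<inter> ball 0 (1/2)"
    using F_z0 z0 by simp
  ultimately obtain d where d: "0 < d" "ball z0 d \<subseteq> {z. q + \<eta> < F z} \<inter> ball 0 (1/2)"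
    by (meson openE)
  have f: "f absolutely_integrable_on ball 0 1" and e0: "(e \<longlongrightarrow> 0) (at_right 0)"
    and ev: "\<forall>\<^sub>F r in at_right 0. (\<lambda>y. blowup u x r y - c r) absolutely_integrable_on ball 0 1"
    using L1 by (simp_all add: L1_tendsto_def e_def[abs_def])
  \<comment> \<open>The first term absorbs the error \<open>2 * e r\<close> in the undilated test,
    the second the error \<open>?N * (2 * e r)\<close> after halving.\<close>
  define \<epsilon> where "\<epsilon> = min ((q - cube_difference f a b s) / 2) (\<eta> / (2 * ?N))"
  have "0 < \<epsilon>"
    using q1 \<eta> by (simp add: \<epsilon>_def)
  then have "\<forall>\<^sub>F r in at_right 0. e r < \<epsilon> \<and> (\<lambda>y. blowup u x r y - c r) absolutely_integrable_on ball 0 1"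
    using order_tendstoD(2)[OF e0] ev eventually_conj by blast
  then obtain \<rho> where \<rho>: "0 < \<rho>" "\<And>r. \<lbrakk>0 < r; r < \<rho>\<rbrakk> \<Longrightarrow>
      e r < \<epsilon> \<and> (\<lambda>y. blowup u x r y - c r) absolutely_integrable_on ball 0 1"
    unfolding eventually_at_right_field by auto
  have main: "cube_difference (blowup u x r) a b s < q \<and>
     q < cube_difference (\<lambda>y. blowup u x r (z + (1/2) *\<^sub>R y)) a b s"
    if r: "0 < r" "r < \<rho>" and z: "z \<in> ball z0 d" for r z
  proof
    have er: "e r < \<epsilon>" and g: "(\<lambda>y. blowup u x r y - c r) absolutely_integrable_on ball 0 1"
      using \<rho>(2)[OF r] by auto
    have "\<bar>cube_difference (blowup u x r) a b s - cube_difference f a b s\<bar> \<le> 2 * e r"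
      unfolding e_def by (rule cube_difference_L1_estimate[OF f g s a b])
    then show "cube_difference (blowup u x r) a b s < q"
      using er by (simp add: \<epsilon>_def field_simps abs_le_iff)
    have z': "norm z < 1/2" "q + \<eta> < F z"
      using d(2) z by auto
    have "(\<lambda>y. (blowup u x r y - c r) + c r) absolutely_integrable_on ball 0 1"
      by (intro set_integral_add(1) g absolutely_integrable_on_const) auto
    then have "blowup u x r absolutely_integrable_on ball 0 1"
      by simp
    then have 1: "cube_difference (\<lambda>y. blowup u x r (z + (1/2) *\<^sub>R y)) a b s =
      ?N * cube_difference (blowup u x r) (z + (1/2) *\<^sub>R a) (z + (1/2) *\<^sub>R b) (s/2)"
      by (rule cube_difference_half[OF _ s z'(1) a b])
    have half: "norm (z + (1/2) *\<^sub>R p) + s/2 * norm (One :: 'a) < 1"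
      if "norm p + s * norm (One :: 'a) < 1" for p
      using that z'(1) norm_triangle_ineq[of z "(1/2) *\<^sub>R p"] by simp
    have "\<bar>cube_difference (blowup u x r) (z + (1/2) *\<^sub>R a) (z + (1/2) *\<^sub>R b) (s/2)
        - cube_difference f (z + (1/2) *\<^sub>R a) (z + (1/2) *\<^sub>R b) (s/2)\<bar> \<le> 2 * e r"
      unfolding e_def using s by (intro cube_difference_L1_estimate[OF f g] half a b) auto
    then have "?N * (cube_difference f (z + (1/2) *\<^sub>R a) (z + (1/2) *\<^sub>R b) (s/2)
        - cube_difference (blowup u x r) (z + (1/2) *\<^sub>R a) (z + (1/2) *\<^sub>R b) (s/2)) \<le> ?N * (2 * e r)"
      by (intro mult_left_mono) auto
    moreover have "?N * (2 * e r) < \<eta>"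
      using er by (simp add: \<epsilon>_def field_simps)
    ultimately show "q < cube_difference (\<lambda>y. blowup u x r (z + (1/2) *\<^sub>R y)) a b s"
      using z'(2) unfolding 1 F_def by (simp add: right_diff_distrib)
  qed
  show ?thesis
  proof (rule that[OF d(1) \<rho>(1)])
    fix d' \<rho>' assume "d' \<le> d" "\<rho>' \<le> \<rho>"
    then show "x \<in> separated_points u a b z0 s q d' \<rho>'"
      unfolding separated_points_def by (intro CollectI allI impI main) auto
  qed
qed

section \<open>Assembling the countable cover\<close>

theorem mainTheorem3:
  fixes \<Omega> :: "(real ^ 'n) set" and u :: "real ^ 'n \<Rightarrow> real" and S :: "(real ^ 'n) set"
  assumes "open \<Omega>"
    and "locally_L1 u \<Omega>"
  defines "S \<equiv> {x \<in> \<Omega>. \<exists>(c :: real \<Rightarrow> real) v.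
      v absolutely_integrable_on ball 0 1 \<and> \<not> ae_constant_on v (ball 0 1) \<and>
      L1_tendsto (ball 0 1) (\<lambda>r y. blowup u x r y - c r) v (at_right 0)}"
  shows "singular_set u \<Omega> \<subseteq> S \<and>
    (\<exists>\<G>. countable \<G> \<and> (\<forall>G\<in>\<G>. lipschitz_graph G) \<and> S \<subseteq> \<Union>\<G>)"
proof
  show "singular_set u \<Omega> \<subseteq> S"
  proof
    fix x assume "x \<in> singular_set u \<Omega>"
    then obtain v where "x \<in> \<Omega>" "v absolutely_integrable_on ball 0 1"
      "\<not> ae_constant_on v (ball 0 1)" "L1_tendsto (ball 0 1) (blowup u x) v (at_right 0)"
      unfolding singular_set_def by auto
    then show "x \<in> S"
      unfolding S_def by (intro CollectI conjI exI[of _ "\<lambda>_. 0"] exI[of _ v]) simp_all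
  qed
next
  obtain D3 :: "((real ^ 'n) \<times> (real ^ 'n) \<times> (real ^ 'n)) set"
    where D3: "countable D3" "\<And>X. open X \<Longrightarrow> X \<noteq> {} \<Longrightarrow> \<exists>d\<in>D3. d \<in> X"
    by (rule countable_dense_setE) blast
  obtain D1 :: "(real ^ 'n) set"
    where D1: "countable D1" "\<And>X. open X \<Longrightarrow> X \<noteq> {} \<Longrightarrow> \<exists>d\<in>D1. d \<in> X"
    by (rule countable_dense_setE) blast
  \<comment> \<open>The index records the cubes and the direction, a centre for localization, the
    separating rational, the exponent of the side, and \<open>d\<close> and \<open>\<rho>\<close>
    rounded to reciprocals of positive integers.\<close>
  define piece where "piece = (\<lambda>((a, b, z0), p, q :: rat, j, k, m).
    separated_points u a b z0 ((1/2)^j) (of_rat q) (inverse (Suc k)) (inverse (Suc m))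
      \<inter> ball p (inverse (Suc m) * norm z0 / 4))"
  define I where "I = {i \<in> D3 \<times> D1 \<times> (UNIV :: (rat \<times> nat \<times> nat \<times> nat) set). snd (snd (fst i)) \<noteq> 0}"
  have "countable I"
    unfolding I_def using D3(1) D1(1)
    by (intro countable_subset[OF Collect_restrict] countable_SIGMA) auto
  have "\<exists>G. lipschitz_graph G \<and> piece i \<subseteq> G" if "i \<in> I" for i
  proof -
    obtain a b z0 p q j k m where i: "i = ((a, b, z0), p, q, j, k, m)"
      by (metis surj_pair)
    then have "z0 \<noteq> 0"
      using that by (simp add: I_def)
    then show ?thesis
      using separated_points_localized_subset_lipschitz_graph[of z0 "inverse (Suc k)"]
      unfolding i piece_def prod.case by (metis inverse_positive_iff_positive of_nat_0_less_iff zero_less_Suc)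
  qed
  then obtain graph where graph: "\<And>i. i \<in> I \<Longrightarrow> lipschitz_graph (graph i) \<and> piece i \<subseteq> graph i"
    by metis
  have "S \<subseteq> (\<Union>i\<in>I. piece i)"
  proof
    fix x assume "x \<in> S"
    then obtain c v where v: "v absolutely_integrable_on ball 0 1" "\<not> ae_constant_on v (ball 0 1)"
      and L1: "L1_tendsto (ball 0 1) (\<lambda>r y. blowup u x r y - c r) v (at_right 0)"
      unfolding S_def by auto
    \<comment> \<open>Extension by zero makes the limit integrable on every box without changing it
      on the unit ball, where the L1 convergence takes place.\<close>
    define f where "f y = (if y \<in> ball 0 1 then v y else 0)" for y
    have fU: "f absolutely_integrable_on UNIV"
      unfolding f_def absolutely_integrable_restrict_UNIV by (fact v(1))
    have int: "f integrable_on cbox a b" for a b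
      using absolutely_integrable_on_subcbox[OF fU] set_lebesgue_integral_eq_integral(1) by blast
    have nc: "\<not> ae_constant_on f (ball 0 1)"
      using v(2) unfolding ae_constant_on_def f_def by (simp cong: imp_cong)
    have "(LINT y:ball 0 1|lebesgue. \<bar>h y - f y\<bar>) = (LINT y:ball 0 1|lebesgue. \<bar>h y - v y\<bar>)" for h
      unfolding set_lebesgue_integral_def f_def
      by (intro Bochner_Integration.integral_cong) (auto simp: indicator_def)
    moreover have "f absolutely_integrable_on ball 0 1"
      by (rule set_integrable_subset[OF fU]) auto
    ultimately have L1': "L1_tendsto (ball 0 1) (\<lambda>r y. blowup u x r y - c r) f (at_right 0)"
      using L1 by (simp add: L1_tendsto_def)
    obtain a b z0 j where D: "(a, b, z0) \<in> D3" and z0: "z0 \<noteq> 0" "norm z0 < 1/2"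
      and ab: "norm a + (1/2)^j * norm (One :: real ^ 'n) < 1" "norm b + (1/2)^j * norm (One :: real ^ 'n) < 1"
      and less: "cube_difference f a b ((1/2)^j) < 2 ^ DIM(real ^ 'n) *
        cube_difference f (z0 + (1/2) *\<^sub>R a) (z0 + (1/2) *\<^sub>R b) ((1/2)^j / 2)"
      using nonconstant_imp_halving_test[OF int nc D3(2)] by blast
    obtain q :: rat where q: "cube_difference f a b ((1/2)^j) < of_rat q"
      "of_rat q < 2 ^ DIM(real ^ 'n) * cube_difference f (z0 + (1/2) *\<^sub>R a) (z0 + (1/2) *\<^sub>R b) ((1/2)^j / 2)"
      using of_rat_dense[OF less] by blast
    obtain d \<rho> where "0 < d" "0 < \<rho>"
      and sep: "\<And>d' \<rho>'. \<lbrakk>d' \<le> d; \<rho>' \<le> \<rho>\<rbrakk> \<Longrightarrow> x \<in> separated_points u a b z0 ((1/2)^j) (of_rat q) d' \<rho>'"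
      using L1_tendsto_imp_separated_point[OF int L1' z0(2) ab _ q] by auto
    then obtain k m where km: "inverse (Suc k) < d" "inverse (Suc m) < \<rho>"
      by (meson reals_Archimedean)
    have "0 < inverse (Suc m) * norm z0 / 4"
      using z0(1) by simp
    then have "ball x (inverse (Suc m) * norm z0 / 4) \<noteq> {}"
      by (simp only: ball_eq_empty not_le)
    \<comment> \<open>A centre from the dense set close to \<open>x\<close>; by symmetry of the
      distance, \<open>x\<close> lies in the localizing ball around \<open>p\<close>.\<close>
    then obtain p where p: "p \<in> D1" "p \<in> ball x (inverse (Suc m) * norm z0 / 4)"
      using D1(2)[OF open_ball] by blast
    have "x \<in> piece ((a, b, z0), p, q, j, k, m)"
      using sep km p(2) by (auto simp: piece_def dist_commute)
    moreover have "((a, b, z0), p, q, j, k, m) \<in> I"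
      using D p(1) z0(1) by (simp add: I_def)
    ultimately show "x \<in> (\<Union>i\<in>I. piece i)"
      by blast
  qed
  then show "\<exists>\<G>. countable \<G> \<and> (\<forall>G\<in>\<G>. lipschitz_graph G) \<and> S \<subseteq> \<Union>\<G>"
    using graph \<open>countable I\<close> by (intro exI[of _ "graph ` I"]) fastforce
qed

end
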